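(* Let $n$ be a positive integer for which a Hadamard matrix of order $n$ exists, let $\lambda=(\lambda_1,\dots,\lambda_n)^\top\in\operatorname{conv}(M_n)$, $D=\operatorname{diag}(\lambda)$, $\Lambda=\{\lambda_1,\dots,\lambda_n\}$ (as a multiset), and let $H$ be a normalized Hadamard matrix of order $n$. Then the matrix $n^{-1}HDH^\top$ is a symmetric, doubly stochastic matrix with spectrum $\Lambda$ (counting multiplicities).
   Context: Let $M_1:=[1]$ and, for $n>1$, $M_n:=\begin{bmatrix}1&e^\top\\ e&-I\end{bmatrix}\in M_n(\mathbb{R})$, where $e\in\mathbb{R}^{n-1}$ is the all-ones column vector and $I$ is the identity matrix of order $n-1$. $\operatorname{conv}(M_n)$ is the convex hull of the columns of $M_n$. A Hadamard matrix of order $n$ is an $n\times n$ matrix $H$ with entries in $\{-1,1\}$ and $HH^\top=nI$; it is normalized if all entries of its first row and first column are positive (equal to $1$). A doubly stochastic matrix is an entrywise nonnegative matrix all of whose row sums and column sums equal $1$. *)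

theory Defs
  imports Complex_Main "Jordan_Normal_Form.Char_Poly"
begin

(* Indices start at 0. The off-diagonal entries of the block -I are 0. For n = 1 this is [1]. *)
definition M_mat :: "nat \<Rightarrow> real mat" where
  "M_mat n = mat n n (\<lambda>(i, j). if i = 0 \<or> j = 0 then 1 else if i = j then - 1 else 0)"

(* The type vec is not an instance of real_vector, so the library constant for convex hulls
   does not apply. A *v c is the sum of the columns col A j weighted by c $ j. *)
definition conv_cols :: "real mat \<Rightarrow> real vec set" where
  "conv_cols A = {A *\<^sub>v c | c. c \<in> carrier_vec (dim_col A) \<and>
     (\<forall>j < dim_col A. 0 \<le> c $ j) \<and> (\<Sum>j < dim_col A. c $ j) = 1}"

definition hadamard :: "nat \<Rightarrow> real mat \<Rightarrow> bool" where
  "hadamard n H \<longleftrightarrow> H \<in> carrier_mat n n \<and>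
     (\<forall>i < n. \<forall>j < n. H $$ (i, j) \<in> {- 1, 1}) \<and>
     H * transpose_mat H = real n \<cdot>\<^sub>m 1\<^sub>m n"

definition normalized_hadamard :: "nat \<Rightarrow> real mat \<Rightarrow> bool" where
  "normalized_hadamard n H \<longleftrightarrow> hadamard n H \<and>
     (\<forall>i < n. 0 < H $$ (i, 0)) \<and> (\<forall>j < n. 0 < H $$ (0, j))"

definition doubly_stochastic :: "nat \<Rightarrow> real mat \<Rightarrow> bool" where
  "doubly_stochastic n A \<longleftrightarrow> A \<in> carrier_mat n n \<and>
     (\<forall>i < n. \<forall>j < n. 0 \<le> A $$ (i, j)) \<and>
     (\<forall>i < n. (\<Sum>j < n. A $$ (i, j)) = 1) \<and>
     (\<forall>j < n. (\<Sum>i < n. A $$ (i, j)) = 1)"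

(* All complex eigenvalues of a real matrix, with algebraic multiplicity. *)
definition spectrum_mset :: "real mat \<Rightarrow> complex multiset" where
  "spectrum_mset A = proots (char_poly (map_mat complex_of_real A))"

end

theory Submission
  imports Defs
begin

text \<open>Since \<open>H\<^sup>-\<^sup>1 = n\<^sup>-\<^sup>1 H\<^sup>T\<close>, the matrix \<open>A\<close> is similar to \<open>D\<close>. Row sums come from \<open>H\<^sup>T e = n e\<^sub>0\<close> and
  \<open>\<lambda>\<^sub>0 = 1\<close>. A point \<open>M\<^sub>n c\<close> of the convex hull has coordinates \<open>\<lambda>\<^sub>k = c\<^sub>0 - c\<^sub>k + [k = 0]\<close>; writing
  \<open>v\<close> for the entrywise product of two rows of \<open>H\<close>, the corresponding entry of \<open>n A\<close> is therefore
  \<open>c\<^sub>0 \<Sum>v\<^sub>k - \<Sum>v\<^sub>k c\<^sub>k + 1\<close>, which is nonnegative because \<open>\<Sum>v\<^sub>k \<in> {0, n}\<close>, \<open>v\<^sub>k \<le> 1\<close> and \<open>\<Sum>c\<^sub>k = 1\<close>.\<close>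

lemma conv_cols_M_mat_coords:
  assumes "lam \<in> conv_cols (M_mat n)"
  obtains c :: "real vec" where "\<And>k. k < n \<Longrightarrow> 0 \<le> c $ k" and "(\<Sum>k<n. c $ k) = 1"
    and "\<And>k. k < n \<Longrightarrow> lam $ k = c $ 0 - c $ k + (if k = 0 then 1 else 0)"
proof -
  have [simp]: "dim_col (M_mat n) = n" "dim_row (M_mat n) = n"
    by (simp_all add: M_mat_def)
  from assms obtain c where lam: "lam = M_mat n *\<^sub>v c" and dim: "c \<in> carrier_vec n"
    and nonneg: "\<forall>k<n. 0 \<le> c $ k" and sum: "(\<Sum>k<n. c $ k) = 1"
    unfolding conv_cols_def by auto
  have "lam $ k = c $ 0 - c $ k + (if k = 0 then 1 else 0)" if k: "k < n" for k
  proof -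
    have lam_k: "lam $ k = (\<Sum>j<n. M_mat n $$ (k, j) * c $ j)"
      using k dim by (simp add: lam scalar_prod_def atLeast0LessThan)
    show ?thesis
    proof (cases "k = 0")
      case True
      \<comment> \<open>Row 0 of \<open>M_mat n\<close> is all ones, so the coordinate is the total
        weight 1; the formula writes it as \<open>c $ 0 - c $ 0 + 1\<close>.\<close>
      then show ?thesis using lam_k k sum by (simp add: M_mat_def)
    next
      case False
      \<comment> \<open>Row \<open>k\<close> has only two nonzero entries, 1 in column 0 and -1 in
        column \<open>k\<close>; each becomes a sum with a single nonzero term.\<close>
      have "(\<Sum>j<n. M_mat n $$ (k, j) * c $ j)
          = (\<Sum>j<n. (if j = 0 then c $ j else 0) - (if j = k then c $ j else 0))"
        using k False by (intro sum.cong) (auto simp: M_mat_def)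
      then show ?thesis using lam_k k False by (simp add: sum_subtractf)
    qed
  qed
  with nonneg sum that show thesis by blast
qed

lemma hadamard_rows:
  assumes "hadamard n H" "i < n" "j < n"
  shows "(\<Sum>k<n. H $$ (i, k) * H $$ (j, k)) = (if i = j then real n else 0)"
proof -
  have "H \<in> carrier_mat n n" and "(H * transpose_mat H) $$ (i, j) = (real n \<cdot>\<^sub>m 1\<^sub>m n) $$ (i, j)"
    using assms by (simp_all add: hadamard_def)
  then show ?thesis
    using assms(2,3) by (simp add: scalar_prod_def atLeast0LessThan)
qed

text \<open>Dividing the defining equation by \<open>n\<close> gives a right inverse, and a right
  inverse of a square matrix is also a left inverse.\<close>

lemma hadamard_inverse:
  assumes "0 < n" "hadamard n H"
  shows "H * ((1 / real n) \<cdot>\<^sub>m transpose_mat H) = 1\<^sub>m n"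
    and "((1 / real n) \<cdot>\<^sub>m transpose_mat H) * H = 1\<^sub>m n"
proof -
  have H: "H \<in> carrier_mat n n" and HHt: "H * transpose_mat H = real n \<cdot>\<^sub>m 1\<^sub>m n"
    using assms(2) by (simp_all add: hadamard_def)
  have "H * ((1 / real n) \<cdot>\<^sub>m transpose_mat H) = (1 / real n) \<cdot>\<^sub>m (H * transpose_mat H)"
    using H by (intro mult_smult_distrib) auto
  also have "\<dots> = 1\<^sub>m n"
    unfolding HHt using assms(1) by (intro eq_matI) auto
  finally show "H * ((1 / real n) \<cdot>\<^sub>m transpose_mat H) = 1\<^sub>m n" .
  then show "((1 / real n) \<cdot>\<^sub>m transpose_mat H) * H = 1\<^sub>m n"
    by (rule mat_mult_left_right_inverse[OF H, rotated]) (use H in auto)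
qed

text \<open>The left inverse gives orthogonality of the columns, which is what the column sums of
  \<open>H\<close> require.\<close>

lemma hadamard_transpose:
  assumes "0 < n" "hadamard n H"
  shows "hadamard n (transpose_mat H)"
proof -
  have H: "H \<in> carrier_mat n n" and ent: "\<forall>i<n. \<forall>j<n. H $$ (i, j) \<in> {- 1, 1}"
    using assms(2) by (simp_all add: hadamard_def)
  have "(1 / real n) \<cdot>\<^sub>m (transpose_mat H * H) = 1\<^sub>m n"
    using hadamard_inverse(2)[OF assms] mult_smult_assoc_mat[of "transpose_mat H" n n H n] H by simp
  then have "real n \<cdot>\<^sub>m ((1 / real n) \<cdot>\<^sub>m (transpose_mat H * H)) = real n \<cdot>\<^sub>m 1\<^sub>m n"
    by simp
  moreover have "real n \<cdot>\<^sub>m ((1 / real n) \<cdot>\<^sub>m (transpose_mat H * H)) = transpose_mat H * H"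
    using assms(1) by (intro eq_matI) auto
  ultimately show ?thesis using H ent by (auto simp: hadamard_def)
qed

lemma normalized_hadamard_ones:
  assumes "normalized_hadamard n H" "i < n"
  shows "H $$ (i, 0) = 1"
proof -
  have "0 < H $$ (i, 0)" "H $$ (i, 0) \<in> {- 1, 1}"
    using assms by (auto simp: normalized_hadamard_def hadamard_def)
  then show ?thesis by auto
qed

lemma char_poly_mat_diag:
  "char_poly (mat_diag n f) = (\<Prod>i\<leftarrow>[0..<n]. [:- f i, 1:])"
proof -
  have "char_poly (mat_diag n f) = (\<Prod>a\<leftarrow>diag_mat (mat_diag n f). [:- a, 1:])"
    by (rule char_poly_upper_triangular[of _ n]) (auto simp: mat_diag_def)
  also have "diag_mat (mat_diag n f) = map f [0..<n]"
    by (auto simp: diag_mat_def mat_diag_def)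
  finally show ?thesis by (simp add: comp_def)
qed

lemma proots_prod_linear_factors:
  fixes f :: "'b \<Rightarrow> 'a :: idom"
  shows "proots (\<Prod>i\<leftarrow>xs. [:- f i, 1:]) = image_mset f (mset xs)"
proof (induction xs)
  case (Cons x xs)
  \<comment> \<open>\<open>proots\<close> is additive only over products of nonzero
    polynomials.\<close>
  have "(\<Prod>i\<leftarrow>xs. [:- f i, 1:]) \<noteq> 0"
    by (auto simp: prod_list_zero_iff)
  then have "proots ([:- f x, 1:] * (\<Prod>i\<leftarrow>xs. [:- f i, 1:]))
      = proots [:- f x, 1:] + proots (\<Prod>i\<leftarrow>xs. [:- f i, 1:])"
    by (intro proots_mult) auto
  then show ?case using Cons.IH by (simp del: mult_pCons_left)
qed simp

lemma spectrum_mset_similar_mat_diag: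
  assumes "similar_mat A (mat_diag n f)" "A \<in> carrier_mat n n"
  shows "spectrum_mset A = image_mset complex_of_real (image_mset f (mset_set {..<n}))"
proof -
  let ?C = "map_mat complex_of_real"
  \<comment> \<open>Similarity is known over the reals, while the spectrum is taken over the complex
    numbers. The characteristic polynomial commutes with the embedding, so similarity is applied to
    the real polynomials in between.\<close>
  have "char_poly (?C A) = map_poly complex_of_real (char_poly A)"
    by (rule of_real_hom.char_poly_hom[OF assms(2)])
  also have "char_poly A = char_poly (mat_diag n f)"
    by (rule char_poly_similar[OF assms(1)])
  also have "map_poly complex_of_real \<dots> = char_poly (?C (mat_diag n f))"
    by (rule of_real_hom.char_poly_hom[OF mat_diag_dim, symmetric])
  also have "?C (mat_diag n f) = mat_diag n (\<lambda>i. complex_of_real (f i))"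
    by (intro eq_matI) (auto simp: mat_diag_def)
  finally have "spectrum_mset A = image_mset (\<lambda>i. complex_of_real (f i)) (mset [0..<n])"
    by (simp add: spectrum_mset_def char_poly_mat_diag proots_prod_linear_factors)
  then show ?thesis
    by (simp add: multiset.map_comp comp_def atLeast0LessThan)
qed

theorem theorem6p6:
  fixes n :: nat and lam :: "real vec" and H D A :: "real mat" and Lam :: "real multiset"
  assumes "0 < n"
    and "\<exists>K. hadamard n K"
    and "lam \<in> conv_cols (M_mat n)"
    and "D = mat_diag n (\<lambda>i. lam $ i)"
    and "Lam = image_mset (\<lambda>i. lam $ i) (mset_set {..<n})"
    and "normalized_hadamard n H"
    and "A = (1 / real n) \<cdot>\<^sub>m (H * D * transpose_mat H)"
  shows "transpose_mat A = A \<and> doubly_stochastic n A \<and>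
         spectrum_mset A = image_mset complex_of_real Lam"
proof -
  have had: "hadamard n H" using assms(6) by (simp add: normalized_hadamard_def)
  then have H: "H \<in> carrier_mat n n" by (simp add: hadamard_def)
  have D: "D \<in> carrier_mat n n" by (simp add: assms(4))
  have A: "A \<in> carrier_mat n n" using H D by (simp add: assms(7))
  obtain c :: "real vec" where c_nonneg: "\<And>k. k < n \<Longrightarrow> 0 \<le> c $ k"
    and c_sum: "(\<Sum>k<n. c $ k) = 1"
    and lam: "\<And>k. k < n \<Longrightarrow> lam $ k = c $ 0 - c $ k + (if k = 0 then 1 else 0)"
    using conv_cols_M_mat_coords[OF assms(3)] by blast
  have entry: "A $$ (i, j) = (\<Sum>k<n. H $$ (i, k) * H $$ (j, k) * lam $ k) / real n"
    if "i < n" "j < n" for i j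
    using that H unfolding assms(7,4) mat_diag_mult_right[OF H]
    by (simp add: scalar_prod_def atLeast0LessThan mult_ac)
  have sym: "A $$ (i, j) = A $$ (j, i)" if "i < n" "j < n" for i j
    using that by (simp add: entry mult.commute)
  then have "transpose_mat A = A" using A by (intro eq_matI) auto
  moreover have nonneg: "0 \<le> A $$ (i, j)" if ij: "i < n" "j < n" for i j
  proof -
    define v where "v k = H $$ (i, k) * H $$ (j, k)" for k
    have "v 0 = 1"
      using normalized_hadamard_ones[OF assms(6)] ij by (simp add: v_def)
    have "v k \<le> 1" if "k < n" for k
    proof -
      have "H $$ (i, k) \<in> {- 1, 1}" "H $$ (j, k) \<in> {- 1, 1}"
        using had ij that by (auto simp: hadamard_def)
      then show ?thesis by (auto simp: v_def)
    qed
    then have "(\<Sum>k<n. v k * c $ k) \<le> (\<Sum>k<n. c $ k)"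
      using c_nonneg mult_right_mono[of "v k" 1 "c $ k" for k] by (intro sum_mono) simp
    \<comment> \<open>By orthogonality of the rows, the sum of \<open>v\<close> is \<open>n\<close>
      if \<open>i = j\<close> and 0 otherwise.\<close>
    moreover have "0 \<le> c $ 0 * (\<Sum>k<n. v k)"
      using hadamard_rows[OF had ij] c_nonneg[OF assms(1)] by (simp add: v_def)
    \<comment> \<open>The summand 1 is \<open>v 0\<close>, contributed by the extra 1 in
      \<open>lam $ 0\<close>. It offsets the subtracted sum, which is at most 1.\<close>
    moreover have "(\<Sum>k<n. v k * lam $ k) = c $ 0 * (\<Sum>k<n. v k) - (\<Sum>k<n. v k * c $ k) + 1"
    proof -
      have "(\<Sum>k<n. v k * lam $ k)
          = (\<Sum>k<n. c $ 0 * v k - v k * c $ k + (if k = 0 then v k else 0))"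
        by (intro sum.cong) (auto simp: lam algebra_simps)
      then show ?thesis
        using assms(1) \<open>v 0 = 1\<close>
        by (simp add: sum.distrib sum_subtractf flip: sum_distrib_left)
    qed
    ultimately show ?thesis
      using ij c_sum by (simp add: entry flip: v_def)
  qed
  moreover have rows: "(\<Sum>j<n. A $$ (i, j)) = 1" if i: "i < n" for i
  proof -
    \<comment> \<open>Column 0 of \<open>H\<close> is all ones, so this sum is the inner product of
      columns \<open>k\<close> and 0.\<close>
    have col: "(\<Sum>j<n. H $$ (j, k)) = (if k = 0 then real n else 0)" if k: "k < n" for k
      using hadamard_rows[OF hadamard_transpose[OF assms(1) had] k assms(1)]
        normalized_hadamard_ones[OF assms(6)] H k assms(1) by simp
    have "real n * (\<Sum>j<n. A $$ (i, j))
        = (\<Sum>j<n. \<Sum>k<n. H $$ (i, k) * H $$ (j, k) * lam $ k)"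
      using i assms(1) by (simp add: entry flip: sum_divide_distrib)
    also have "\<dots> = (\<Sum>k<n. H $$ (i, k) * lam $ k * (\<Sum>j<n. H $$ (j, k)))"
      by (subst sum.swap) (simp add: sum_distrib_left mult_ac)
    also have "\<dots> = (\<Sum>k<n. if k = 0 then H $$ (i, k) * lam $ k * real n else 0)"
      by (intro sum.cong) (auto simp: col)
    \<comment> \<open>Only \<open>k = 0\<close> survives, where \<open>H $$ (i, 0) = 1\<close> and
      \<open>lam $ 0 = 1\<close>.\<close>
    also have "\<dots> = real n"
      using assms(1) i lam[OF assms(1)] normalized_hadamard_ones[OF assms(6)] by simp
    finally show ?thesis using assms(1) by simp
  qed
  \<comment> \<open>By symmetry, a column sum is the row sum with the same index.\<close>
  moreover have "(\<Sum>i<n. A $$ (i, j)) = 1" if j: "j < n" for j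
    using rows[OF j] j sym by simp
  moreover have "spectrum_mset A = image_mset complex_of_real Lam"
    unfolding assms(5)
  proof (rule spectrum_mset_similar_mat_diag[OF _ A], fold assms(4))
    show "similar_mat A D"
    proof (rule similar_matI[OF _ hadamard_inverse[OF assms(1) had]])
      \<comment> \<open>Moving the scalar onto the last factor turns that factor into the inverse of
        \<open>H\<close>.\<close>
      show "A = H * D * ((1 / real n) \<cdot>\<^sub>m transpose_mat H)"
        unfolding assms(7) using H D by (intro mult_smult_distrib[symmetric]) auto
    qed (use A D H in auto)
  qed
  ultimately show ?thesis using A by (simp add: doubly_stochastic_def)
qed

end
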